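(* Let $\omega$ be a probability distribution on $(0,1)$ such that: (i) $\omega$ is not supported by a geometric sequence, i.e. there is no $x\in(0,1)$ with $\omega(\{1-x^j:j=1,2,\ldots\})=1$; (ii) $\int_0^1|\log x|\,\omega(\mathrm{d}x)<\infty$; (iii) $\nu:=\int_0^1(\log(1-x))^2\,\omega(\mathrm{d}x)<\infty$. Put $\mu:=\int_0^1|\log(1-x)|\,\omega(\mathrm{d}x)$ and $\sigma:=\sqrt{\nu-\mu^2}$. Then, as $n\to\infty$, $$\frac{K_n-\mu^{-1}\log n}{\sigma\,\mu^{-3/2}\,\sqrt{\log n}}$$ converges weakly (in distribution) to the standard normal random variable.
   Context: Definition of $K_n$: let $X_1,X_2,\ldots$ be i.i.d. with distribution $\omega$, and let $U_1,U_2,\ldots$ be i.i.d. uniform on $[0,1]$, independent of $(X_j)$. Put $P_0=0$ and $P_j=1-\prod_{i=1}^j(1-X_i)$. Then $K_n$ is the number of $j\ge1$ such that the interval $(P_{j-1},P_j)$ contains at least one of $U_1,\ldots,U_n$. *)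

theory Defs
  imports "HOL-Probability.Probability"
begin

text \<open>
  The variables \<open>X\<close> and \<open>U\<close> are indexed from \<open>0\<close>, so \<open>X i\<close> and \<open>U i\<close> stand for
  \<open>X\<^sub>i\<^sub>+\<^sub>1\<close> and \<open>U\<^sub>i\<^sub>+\<^sub>1\<close>. The points \<open>P\<^sub>j\<close> keep their index, with the empty product giving
  \<open>P\<^sub>0 = 0\<close>.
\<close>

definition sieve_point :: "(nat \<Rightarrow> 'a \<Rightarrow> real) \<Rightarrow> nat \<Rightarrow> 'a \<Rightarrow> real" where
  "sieve_point X j w = 1 - (\<Prod>i<j. 1 - X i w)"

text \<open>
  The set below is finite whenever all \<open>X i w\<close> lie in \<open>(0,1)\<close>, because the open intervals are
  then pairwise disjoint; so the convention that an infinite set has cardinality \<open>0\<close>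
  matters at most on a null set.
\<close>

definition occupied_count :: "(nat \<Rightarrow> 'a \<Rightarrow> real) \<Rightarrow> (nat \<Rightarrow> 'a \<Rightarrow> real) \<Rightarrow> nat \<Rightarrow> 'a \<Rightarrow> nat" where
  "occupied_count X U n w =
     card {j. j \<ge> 1 \<and> (\<exists>i<n. U i w \<in> {sieve_point X (j - 1) w <..< sieve_point X j w})}"

end

theory Submission
  imports Defs
begin

text \<open>
  Put \<open>S\<^sub>k = - ln (1 - P\<^sub>k)\<close>, a random walk with positive steps \<open>\<xi>\<^sub>i = - ln (1 - X\<^sub>i)\<close> of mean \<open>\<mu>\<close> and
  variance \<open>\<sigma>\<^sup>2\<close>. With \<open>n\<close> uniform points one expects the intervals that start before \<open>1 - 1 / n\<close>
  to be occupied and the later ones to be empty, up to boundedly many exceptions. So the occupied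
  count should be close to \<open>N\<close>, the number of \<open>k\<close> with \<open>S\<^sub>k < ln n\<close>, and this number obeys a central
  limit theorem because \<open>N \<le> k\<close> holds exactly when \<open>S\<^sub>k \<ge> ln n\<close> (\<open>renewal_clt\<close>).

  The heart of the matter is that the exceptions have bounded mean
  (\<open>expected_distance_to_renewals\<close>). Late occupied intervals are at most as many as the points
  beyond \<open>1 - 1 / n\<close>, whose mean number is \<open>1\<close>. For the early empty intervals, let \<open>x = X\<^sub>k\<^sub>+\<^sub>1\<close> be the
  fraction that the interval \<open>(P\<^sub>k, P\<^sub>k\<^sub>+\<^sub>1)\<close> takes of what \<open>P\<^sub>k\<close> leaves. Given the walk, the interval is
  empty with probability at most the minimum of \<open>1\<close> and \<open>exp (S\<^sub>k - A)\<close>, where \<open>A = ln n + ln x\<close>. As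
  \<open>x\<close> is independent of \<open>S\<^sub>k\<close>, it may be held fixed while these bounds are summed over the positions
  of the walk below \<open>ln n\<close>. As a function of the position the bound is the derivative of a convex
  potential; frozen beyond \<open>ln n + 1\<close>, this potential is at most \<open>2 + \<bar>ln x\<bar>\<close>, and each step of the walk
  raises it in mean by at least \<open>E (min \<xi> 1)\<close> times the bound. Telescoping gives
  \<open>(2 + \<bar>ln x\<bar>) / E (min \<xi> 1)\<close> for the sum (\<open>expected_window_sum\<close>), and the mean over \<open>x\<close> is finite by
  the assumption on \<open>\<bar>ln x\<bar>\<close>. That \<open>\<omega>\<close> is not geometric gives
  \<open>\<sigma> > 0\<close>.
\<close>

section \<open>Convergence of distribution functions\<close>

text \<open>
  Pointwise convergence of monotone functions to a continuous limit tolerates a moving argument: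
  squeeze \<open>F (k t) (y t)\<close> between the values at \<open>x - d\<close> and \<open>x + d\<close>. Inverting the central limit
  theorem below produces such a moving argument.
\<close>

lemma monotone_continuous_convergence:
  fixes F :: "nat \<Rightarrow> real \<Rightarrow> real" and \<Phi> :: "real \<Rightarrow> real"
  assumes mono: "\<And>n. mono (F n)"
    and conv: "\<And>x. (\<lambda>n. F n x) \<longlonglongrightarrow> \<Phi> x"
    and cont: "isCont \<Phi> x"
    and k: "filterlim k sequentially G"
    and y: "(y \<longlongrightarrow> x) G"
  shows "((\<lambda>t. F (k t) (y t)) \<longlongrightarrow> \<Phi> x) G"
proof (rule tendstoI)
  fix e :: real assume "e > 0"
  then obtain d where d: "d > 0" "\<And>z. \<bar>z - x\<bar> \<le> d \<Longrightarrow> \<bar>\<Phi> z - \<Phi> x\<bar> < e / 2"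
  proof -
    from cont \<open>e > 0\<close> obtain d where "d > 0" "\<And>z. dist z x < d \<Longrightarrow> dist (\<Phi> z) (\<Phi> x) < e / 2"
      unfolding continuous_at_eps_delta by (meson half_gt_zero)
    then show ?thesis
      by (intro that[of "d / 2"]) (auto simp: dist_real_def)
  qed
  have near: "\<forall>\<^sub>F t in G. \<bar>F (k t) z - \<Phi> z\<bar> < e / 2" for z
    using tendstoD[OF filterlim_compose[OF conv[of z] k], of "e / 2"] \<open>e > 0\<close>
    by (simp add: dist_real_def)
  have "\<forall>\<^sub>F t in G. \<bar>y t - x\<bar> < d"
    using y \<open>d > 0\<close> by (auto simp: tendsto_iff dist_real_def)
  with near[of "x - d"] near[of "x + d"]
  show "\<forall>\<^sub>F t in G. dist (F (k t) (y t)) (\<Phi> x) < e"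
  proof eventually_elim
    case (elim t)
    have "F (k t) (x - d) \<le> F (k t) (y t)" "F (k t) (y t) \<le> F (k t) (x + d)"
      using elim(3) by (auto intro!: monoD[OF mono])
    moreover have "\<bar>\<Phi> (x - d) - \<Phi> x\<bar> < e / 2" "\<bar>\<Phi> (x + d) - \<Phi> x\<bar> < e / 2"
      using d by auto
    ultimately show ?case using elim(1,2) unfolding dist_real_def by linarith
  qed
qed

text \<open>
  Slutsky's theorem in terms of distribution functions: up to the event that \<open>Y n\<close> and \<open>Z n\<close> differ
  by \<open>d\<close> or more, \<open>Z n \<le> x\<close> lies between \<open>Y n \<le> x - d\<close> and \<open>Y n \<le> x + d\<close>.
\<close>

lemma (in prob_space) cdf_convergence_perturb:
  fixes Y Z :: "nat \<Rightarrow> 'a \<Rightarrow> real" and \<Phi> :: "real \<Rightarrow> real"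
  assumes [measurable]: "\<And>n. Y n \<in> borel_measurable M" "\<And>n. Z n \<in> borel_measurable M"
    and conv: "\<And>x. (\<lambda>n. prob {w \<in> space M. Y n w \<le> x}) \<longlonglongrightarrow> \<Phi> x"
    and cont: "isCont \<Phi> x"
    and close: "\<And>e. e > 0 \<Longrightarrow> (\<lambda>n. prob {w \<in> space M. \<bar>Z n w - Y n w\<bar> \<ge> e}) \<longlonglongrightarrow> 0"
  shows "(\<lambda>n. prob {w \<in> space M. Z n w \<le> x}) \<longlonglongrightarrow> \<Phi> x"
proof (rule tendstoI)
  fix e :: real assume "e > 0"
  then obtain d where d: "d > 0" "\<And>z. \<bar>z - x\<bar> \<le> d \<Longrightarrow> \<bar>\<Phi> z - \<Phi> x\<bar> < e / 3"
  proof -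
    from cont \<open>e > 0\<close> obtain d where "d > 0" "\<And>z. dist z x < d \<Longrightarrow> dist (\<Phi> z) (\<Phi> x) < e / 3"
      unfolding continuous_at_eps_delta by (metis zero_less_divide_iff zero_less_numeral)
    then show ?thesis
      by (intro that[of "d / 2"]) (auto simp: dist_real_def)
  qed
  have near: "\<forall>\<^sub>F n in sequentially. \<bar>prob {w \<in> space M. Y n w \<le> z} - \<Phi> z\<bar> < e / 3" for z
    using tendstoD[OF conv[of z], of "e / 3"] \<open>e > 0\<close> by (simp add: dist_real_def)
  have "\<forall>\<^sub>F n in sequentially. prob {w \<in> space M. \<bar>Z n w - Y n w\<bar> \<ge> d} < e / 3"
    using tendstoD[OF close[OF d(1)], of "e / 3"] \<open>e > 0\<close> by (simp add: dist_real_def)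
  with near[of "x - d"] near[of "x + d"]
  show "\<forall>\<^sub>F n in sequentially. dist (prob {w \<in> space M. Z n w \<le> x}) (\<Phi> x) < e"
  proof eventually_elim
    case (elim n)
    let ?far = "{w \<in> space M. \<bar>Z n w - Y n w\<bar> \<ge> d}"
    have "prob {w \<in> space M. Z n w \<le> x} \<le> prob ({w \<in> space M. Y n w \<le> x + d} \<union> ?far)"
      by (rule finite_measure_mono) auto
    also have "\<dots> \<le> prob {w \<in> space M. Y n w \<le> x + d} + prob ?far"
      by (rule measure_Un_le) auto
    finally have 1: "prob {w \<in> space M. Z n w \<le> x} \<le> \<dots>" .
    have "prob {w \<in> space M. Y n w \<le> x - d} \<le> prob ({w \<in> space M. Z n w \<le> x} \<union> ?far)"
      by (rule finite_measure_mono) auto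
    also have "\<dots> \<le> prob {w \<in> space M. Z n w \<le> x} + prob ?far"
      by (rule measure_Un_le) auto
    finally have 2: "prob {w \<in> space M. Y n w \<le> x - d} \<le> \<dots>" .
    have "\<bar>\<Phi> (x - d) - \<Phi> x\<bar> < e / 3" "\<bar>\<Phi> (x + d) - \<Phi> x\<bar> < e / 3"
      using d by auto
    with 1 2 elim show ?case unfolding dist_real_def by linarith
  qed
qed

lemma isCont_cdf_std_normal: "isCont (cdf std_normal_distribution) x"
proof -
  interpret real_distribution std_normal_distribution
    by (rule real_dist_normal_dist)
  have "emeasure std_normal_distribution {x} = 0"
    by (subst emeasure_density) (auto intro!: nn_integral_null_set)
  then show ?thesis
    by (simp add: isCont_cdf measure_def)
qed

section \<open>Decoupling and counting\<close>

text \<open>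
  Tonelli's theorem for independent variables, with both integrals kept on the original probability
  space so that almost sure statements can be used at either level.
\<close>

lemma (in prob_space) nn_integral_decouple:
  assumes indep: "indep_var S X T Y"
    and f: "f \<in> borel_measurable (S \<Otimes>\<^sub>M T)"
  shows "(\<integral>\<^sup>+w. f (X w, Y w) \<partial>M) = (\<integral>\<^sup>+w'. (\<integral>\<^sup>+w. f (X w', Y w) \<partial>M) \<partial>M)"
proof -
  note eq = indep[unfolded indep_var_distribution_eq]
  then have [measurable]: "X \<in> measurable M S" "Y \<in> measurable M T" by auto
  interpret Y: prob_space "distr M T Y" by (rule prob_space_distr) simp
  have f'[measurable]: "f \<in> borel_measurable (distr M S X \<Otimes>\<^sub>M distr M T Y)"
    using f by simp
  have "(\<integral>\<^sup>+w. f (X w, Y w) \<partial>M) = (\<integral>\<^sup>+p. f p \<partial>distr M (S \<Otimes>\<^sub>M T) (\<lambda>w. (X w, Y w)))"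
    by (subst nn_integral_distr) (use f in auto)
  also have "\<dots> = (\<integral>\<^sup>+p. f p \<partial>(distr M S X \<Otimes>\<^sub>M distr M T Y))"
    using eq by simp
  also have "\<dots> = (\<integral>\<^sup>+x. (\<integral>\<^sup>+y. f (x, y) \<partial>distr M T Y) \<partial>distr M S X)"
    by (rule Y.nn_integral_fst[symmetric]) fact
  also have "\<dots> = (\<integral>\<^sup>+w'. (\<integral>\<^sup>+y. f (X w', y) \<partial>distr M T Y) \<partial>M)"
    by (rule nn_integral_distr) (use f in \<open>auto intro!: Y.borel_measurable_nn_integral\<close>)
  also have "\<dots> = (\<integral>\<^sup>+w'. (\<integral>\<^sup>+w. f (X w', Y w) \<partial>M) \<partial>M)"
    by (intro nn_integral_cong nn_integral_distr)
       (use f measurable_space[OF \<open>X \<in> measurable M S\<close>] in measurable)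
  finally show ?thesis .
qed

text \<open>
  This is only an inequality because the cardinality of an infinite set is \<open>0\<close>.
\<close>

lemma nn_integral_card_le:
  fixes B :: "nat \<Rightarrow> 'a set"
  assumes [measurable]: "\<And>k. B k \<in> sets M"
  shows "(\<integral>\<^sup>+w. of_nat (card {k. w \<in> B k}) \<partial>M) \<le> (\<Sum>k. emeasure M (B k))"
proof -
  have "of_nat (card A) \<le> (\<Sum>k. indicator A k :: ennreal)" for A :: "nat set"
  proof (cases "finite A")
    case True
    then have "(\<Sum>k. indicator A k :: ennreal) = (\<Sum>k\<in>A. indicator A k)"
      by (intro suminf_finite) auto
    also have "\<dots> = of_nat (card A)" by simp
    finally show ?thesis by simp
  qed simp
  then have "(\<integral>\<^sup>+w. of_nat (card {k. w \<in> B k}) \<partial>M) \<le> (\<integral>\<^sup>+w. (\<Sum>k. indicator {k. w \<in> B k} k) \<partial>M)"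
    by (intro nn_integral_mono)
  also have "\<dots> = (\<integral>\<^sup>+w. (\<Sum>k. indicator (B k) w) \<partial>M)"
    by (simp add: indicator_def)
  also have "\<dots> = (\<Sum>k. emeasure M (B k))"
    by (subst nn_integral_suminf) auto
  finally show ?thesis .
qed

text \<open>
  Used with \<open>R i k\<close> saying that point \<open>i\<close> falls into interval \<open>k\<close>: disjointness of the intervals
  gives the uniqueness, and the conclusion bounds the occupied intervals by the points available.
\<close>

lemma card_le_labels:
  assumes "finite I" and uniq: "\<And>i k l. i \<in> I \<Longrightarrow> R i k \<Longrightarrow> R i l \<Longrightarrow> k = l"
  shows "finite {k. \<exists>i\<in>I. R i k}" "card {k. \<exists>i\<in>I. R i k} \<le> card I"
proof -
  have sub: "{k. \<exists>i\<in>I. R i k} \<subseteq> (\<lambda>i. SOME k. R i k) ` I"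
    using uniq by (auto simp: image_iff) (metis someI)
  then show "finite {k. \<exists>i\<in>I. R i k}"
    using \<open>finite I\<close> finite_subset by blast
  show "card {k. \<exists>i\<in>I. R i k} \<le> card I"
    using surj_card_le[OF \<open>finite I\<close> sub] .
qed

section \<open>A bounded potential for walks with positive steps\<close>

text \<open>
  The continuously differentiable function with derivative \<open>min 1 (exp (s - A))\<close> that vanishes at
  \<open>-\<infinity>\<close>.
\<close>

definition potential :: "real \<Rightarrow> real \<Rightarrow> real" where
  "potential A s = (if s \<le> A then exp (s - A) else 1 + s - A)"

text \<open>
  By convexity the function lies above its tangent at \<open>s\<close>.
\<close>

lemma potential_increment:
  assumes "0 \<le> \<eta>"
  shows "\<eta> * min 1 (exp (s - A)) \<le> potential A (s + \<eta>) - potential A s"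
proof -
  have exp_ge: "exp u * (v - u) \<le> exp v - exp u" for u v :: real
    using mult_left_mono[OF exp_ge_add_one_self[of "v - u"], of "exp u"]
    by (simp add: exp_diff algebra_simps)
  consider "s + \<eta> \<le> A" | "s \<le> A" "A < s + \<eta>" | "A < s" by linarith
  then show ?thesis
  proof cases
    case 1
    have "min 1 (exp (s - A)) = exp (s - A)"
      using 1 assms by simp
    then show ?thesis using 1 assms exp_ge[of "s - A" "s + \<eta> - A"]
      by (simp add: potential_def mult.commute)
  next
    case 2
    have "exp (s - A) * (A - s) \<le> 1 - exp (s - A)"
      using exp_ge[of "s - A" 0] by simp
    moreover have "exp (s - A) * (s + \<eta> - A) \<le> 1 * (s + \<eta> - A)"
      using 2 by (intro mult_right_mono) auto
    ultimately have "exp (s - A) * \<eta> \<le> 1 + (s + \<eta>) - A - exp (s - A)"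
      by (simp add: algebra_simps)
    moreover have "min 1 (exp (s - A)) = exp (s - A)"
      using 2 by simp
    ultimately show ?thesis using 2
      by (simp add: potential_def mult.commute)
  next
    case 3
    then have "min 1 (exp (s - A)) = 1" by simp
    then show ?thesis using 3 assms by (simp add: potential_def)
  qed
qed

lemma potential_mono: "s \<le> t \<Longrightarrow> potential A s \<le> potential A t"
  using potential_increment[of "t - s" s A] by (smt (verit) exp_ge_zero mult_nonneg_nonneg)

lemma potential_nonneg: "0 \<le> potential A s"
  by (auto simp: potential_def)

lemma potential_measurable [measurable]: "potential A \<in> borel_measurable borel"
  unfolding potential_def[abs_def] by measurable

lemma potential_bounded:
  assumes "A \<le> L"
  shows "potential A (min s (L + 1)) \<le> 2 + L - A"
proof -
  have "potential A (min s (L + 1)) \<le> potential A (L + 1)"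
    by (rule potential_mono) auto
  also have "\<dots> = 2 + L - A" using assms by (simp add: potential_def)
  finally show ?thesis .
qed

text \<open>
  With \<open>A = L + ln x\<close> and \<open>L = ln n\<close>, the value at \<open>s < L\<close> is the minimum of \<open>1\<close> and \<open>1 / (n x exp (- s))\<close>,
  which bounds the probability that an interval of length \<open>x exp (- s)\<close> is missed by \<open>n\<close> uniform
  points.
\<close>

definition window :: "real \<Rightarrow> real \<Rightarrow> real \<Rightarrow> real" where
  "window L A s = indicat_real {..<L} s * min 1 (exp (s - A))"

lemma window_measurable [measurable (raw)]:
  assumes [measurable]: "f \<in> borel_measurable M" "g \<in> borel_measurable M"
  shows "(\<lambda>x. window L (f x) (g x)) \<in> borel_measurable M"
  unfolding window_def by measurable

lemma window_bounds: "0 \<le> window L A s" "window L A s \<le> 1"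
  by (auto simp: window_def indicator_def)

text \<open>
  Freezing the potential from \<open>L + 1\<close> on makes it bounded; the unit of extra room beyond \<open>L\<close> is what
  a step truncated at \<open>1\<close> can use from a position below \<open>L\<close>.
\<close>

lemma window_le_potential_increment:
  assumes "0 \<le> \<eta>"
  shows "min \<eta> 1 * window L A s \<le> potential A (min (s + \<eta>) (L + 1)) - potential A (min s (L + 1))"
proof (cases "s < L")
  case True
  have "min \<eta> 1 * min 1 (exp (s - A)) \<le> potential A (s + min \<eta> 1) - potential A s"
    by (rule potential_increment) (use assms in auto)
  also have "potential A (s + min \<eta> 1) \<le> potential A (min (s + \<eta>) (L + 1))"
    by (rule potential_mono) (use True in auto)
  finally show ?thesis using True by (simp add: window_def)
next
  case False
  have "potential A (min s (L + 1)) \<le> potential A (min (s + \<eta>) (L + 1))"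
    by (rule potential_mono) (use assms in auto)
  with False show ?thesis by (simp add: window_def)
qed

section \<open>Renewal estimates and the central limit theorem for renewals\<close>

text \<open>
  Steps are positive only almost surely, as nothing more can be read off from their distribution.
\<close>

locale renewal_walk = prob_space +
  fixes \<xi> :: "nat \<Rightarrow> 'a \<Rightarrow> real" and \<rho> :: "real measure"
  assumes indep: "indep_vars (\<lambda>_. borel) \<xi> UNIV"
    and ident: "\<And>i. distr M borel (\<xi> i) = \<rho>"
    and pos: "\<And>i. AE w in M. 0 < \<xi> i w"
begin

definition walk :: "nat \<Rightarrow> 'a \<Rightarrow> real" where
  "walk k w = (\<Sum>i<k. \<xi> i w)"

definition renewals :: "real \<Rightarrow> 'a \<Rightarrow> nat" where
  "renewals L w = card {k. walk k w < L}"

text \<open>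
  Truncation at \<open>1\<close>, because the frozen potential is sure to grow only over the first unit of a step
  from below \<open>L\<close>.
\<close>

definition drift :: real where
  "drift = expectation (\<lambda>w. min (\<xi> 0 w) 1)"

lemma step_measurable [measurable]: "\<xi> i \<in> borel_measurable M"
  using indep by (auto simp: indep_vars_def2)

lemma walk_measurable [measurable]: "walk k \<in> borel_measurable M"
  unfolding walk_def[abs_def] by measurable

lemma renewals_measurable [measurable]: "renewals L \<in> measurable M (count_space UNIV)"
  unfolding renewals_def[abs_def] by measurable

lemma walk_Suc: "walk (Suc k) w = walk k w + \<xi> k w"
  by (simp add: walk_def)

lemma AE_all_pos: "AE w in M. \<forall>i. 0 < \<xi> i w"
  using pos by (simp add: AE_all_countable)

lemma walk_nonneg: "(\<And>i. 0 < \<xi> i w) \<Longrightarrow> 0 \<le> walk k w"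
  unfolding walk_def by (rule sum_nonneg) (simp add: less_imp_le)

lemma integrable_step_min: "integrable M (\<lambda>w. min (\<xi> i w) 1)"
proof (rule integrable_const_bound[where B = 1])
  show "AE w in M. norm (min (\<xi> i w) 1) \<le> 1"
    using pos[of i] by eventually_elim auto
qed measurable

lemma expectation_step_min: "expectation (\<lambda>w. min (\<xi> i w) 1) = drift"
proof -
  have "expectation (\<lambda>w. min (\<xi> j w) 1) = integral\<^sup>L \<rho> (\<lambda>x. min x 1)" for j
    by (subst ident[of j, symmetric], subst integral_distr) auto
  then show ?thesis by (simp add: drift_def)
qed

lemma drift_pos: "0 < drift"
proof -
  have nn: "AE w in M. 0 \<le> min (\<xi> 0 w) 1"
    using pos[of 0] by eventually_elim auto
  have "drift \<noteq> 0"
  proof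
    assume "drift = 0"
    then have "AE w in M. min (\<xi> 0 w) 1 = 0"
      using integral_nonneg_eq_0_iff_AE[OF integrable_step_min nn] by (simp add: drift_def)
    with pos[of 0] have "AE w in M. False" by eventually_elim auto
    then show False by simp
  qed
  moreover have "0 \<le> drift" unfolding drift_def using nn by (rule integral_nonneg_AE)
  ultimately show ?thesis by simp
qed

lemma step_indep_walk: "indep_var borel (\<xi> k) borel (walk k)"
  unfolding walk_def[abs_def]
  by (rule indep_vars_sum) (auto intro: indep_vars_subset[OF indep])

text \<open>
  The renewal estimate. Along the walk the frozen potential gains in expectation at least \<open>drift\<close>
  times the window at the current position, because a step is independent of that position. The
  gains telescope, and the potential never exceeds \<open>2 + L - A\<close>.
\<close>

lemma expected_window_sum:
  assumes "A \<le> L"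
  shows "(\<Sum>k<m. expectation (\<lambda>w. window L A (walk k w))) \<le> (2 + L - A) / drift"
proof -
  define h where "h k w = potential A (min (walk k w) (L + 1))" for k w
  have [measurable]: "h k \<in> borel_measurable M" for k
    unfolding h_def[abs_def] by measurable
  have h_int: "integrable M (h k)" for k
    by (rule integrable_const_bound[where B = "2 + L - A"])
       (auto simp: h_def potential_nonneg potential_bounded[OF assms])
  have w_int: "integrable M (\<lambda>w. window L A (walk k w))" for k
    by (rule integrable_const_bound[where B = 1]) (auto simp: window_bounds)
  have step: "drift * expectation (\<lambda>w. window L A (walk k w)) \<le> expectation (h (Suc k)) - expectation (h k)" for k
  proof -
    have ind: "indep_var borel (\<lambda>w. min (\<xi> k w) 1) borel (\<lambda>w. window L A (walk k w))"
      using indep_var_compose[OF step_indep_walk, of "\<lambda>x. min x 1" borel "window L A" borel k]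
      by (simp add: comp_def)
    have "drift * expectation (\<lambda>w. window L A (walk k w))
        = expectation (\<lambda>w. min (\<xi> k w) 1 * window L A (walk k w))"
      using indep_var_lebesgue_integral[OF ind integrable_step_min w_int]
      by (simp add: expectation_step_min)
    also have "\<dots> \<le> expectation (\<lambda>w. h (Suc k) w - h k w)"
    proof (rule integral_mono_AE)
      show "integrable M (\<lambda>w. min (\<xi> k w) 1 * window L A (walk k w))"
        by (rule indep_var_integrable[OF ind integrable_step_min w_int])
      show "AE w in M. min (\<xi> k w) 1 * window L A (walk k w) \<le> h (Suc k) w - h k w"
        using pos[of k]
        by eventually_elim (simp add: h_def walk_Suc window_le_potential_increment)
    qed (use h_int in auto)
    also have "\<dots> = expectation (h (Suc k)) - expectation (h k)"
      using h_int by simp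
    finally show ?thesis .
  qed
  have "drift * (\<Sum>k<m. expectation (\<lambda>w. window L A (walk k w)))
      \<le> (\<Sum>k<m. expectation (h (Suc k)) - expectation (h k))"
    unfolding sum_distrib_left by (rule sum_mono) (rule step)
  also have "\<dots> = expectation (h m) - expectation (h 0)"
    by (rule sum_lessThan_telescope)
  also have "\<dots> \<le> expectation (h m)"
    by (simp add: h_def potential_nonneg)
  also have "\<dots> \<le> expectation (\<lambda>_. 2 + L - A)"
    by (rule integral_mono[OF h_int]) (auto simp: h_def potential_bounded[OF assms])
  finally show ?thesis
    using drift_pos by (simp add: prob_space field_simps)
qed

text \<open>
  The parameter of the window may depend on the very step that leaves the current position: that
  step is independent of the position, so by decoupling it may be replaced by the first step, the
  same for all \<open>k\<close>, and the renewal estimate applies for each of its values.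
\<close>

lemma expected_decoupled_window_sum:
  assumes a: "a \<in> borel_measurable borel" and aL: "\<And>x. x > 0 \<Longrightarrow> a x \<le> L"
  shows "(\<Sum>k. \<integral>\<^sup>+w. ennreal (window L (a (\<xi> k w)) (walk k w)) \<partial>M)
      \<le> (\<integral>\<^sup>+w. ennreal ((2 + L - a (\<xi> 0 w)) / drift) \<partial>M)"
proof -
  note [measurable] = a
  define g where "g k x = (\<integral>\<^sup>+w. ennreal (window L (a x) (walk k w)) \<partial>M)" for k x
  have g_meas [measurable]: "g k \<in> borel_measurable borel" for k
    unfolding g_def[abs_def] by measurable
  have "(\<integral>\<^sup>+w. ennreal (window L (a (\<xi> k w)) (walk k w)) \<partial>M) = (\<integral>\<^sup>+w. g k (\<xi> 0 w) \<partial>M)" for k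
  proof -
    have "(\<integral>\<^sup>+w. ennreal (window L (a (\<xi> k w)) (walk k w)) \<partial>M) = (\<integral>\<^sup>+w. g k (\<xi> k w) \<partial>M)"
      using nn_integral_decouple[OF step_indep_walk, of "\<lambda>p. ennreal (window L (a (fst p)) (snd p))" k]
      by (simp add: g_def)
    also have "\<dots> = (\<integral>\<^sup>+x. g k x \<partial>distr M borel (\<xi> k))"
      by (rule nn_integral_distr[symmetric]) auto
    also have "\<dots> = (\<integral>\<^sup>+w. g k (\<xi> 0 w) \<partial>M)"
      unfolding ident[of k] ident[of 0, symmetric] by (rule nn_integral_distr) auto
    finally show ?thesis .
  qed
  then have "(\<Sum>k. \<integral>\<^sup>+w. ennreal (window L (a (\<xi> k w)) (walk k w)) \<partial>M) = (\<Sum>k. \<integral>\<^sup>+w. g k (\<xi> 0 w) \<partial>M)"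
    by simp
  also have "\<dots> = (\<integral>\<^sup>+w. (\<Sum>k. g k (\<xi> 0 w)) \<partial>M)"
    by (rule nn_integral_suminf[symmetric]) measurable
  also have "\<dots> \<le> (\<integral>\<^sup>+w. ennreal ((2 + L - a (\<xi> 0 w)) / drift) \<partial>M)"
  proof (rule nn_integral_mono_AE)
    show "AE w in M. (\<Sum>k. g k (\<xi> 0 w)) \<le> ennreal ((2 + L - a (\<xi> 0 w)) / drift)"
      using pos[of 0]
    proof eventually_elim
      case (elim w)
      have g_eq: "g k (\<xi> 0 w) = ennreal (expectation (\<lambda>v. window L (a (\<xi> 0 w)) (walk k v)))" for k
        unfolding g_def
        by (rule nn_integral_eq_integral)
           (auto intro!: integrable_const_bound[where B = 1] simp: window_bounds)
      have "(\<Sum>k<m. g k (\<xi> 0 w)) \<le> ennreal ((2 + L - a (\<xi> 0 w)) / drift)" for m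
        using expected_window_sum[OF aL[OF elim], of m]
        by (simp add: g_eq sum_ennreal integral_nonneg window_bounds ennreal_leI)
      then show ?case by (intro suminf_le_const) auto
    qed
  qed
  finally show ?thesis .
qed

text \<open>
  For \<open>A = 0\<close> the window at nonnegative positions is the indicator of \<open>s < L\<close>, so the renewal
  estimate makes the probabilities of \<open>walk k w < L\<close> summable and the Borel-Cantelli lemma applies.
\<close>

lemma AE_finite_renewals: "AE w in M. finite {k. walk k w < L}"
proof -
  define L' where "L' = max L 0"
  have "(\<Sum>k<m. prob {w \<in> space M. walk k w < L'}) \<le> (2 + L') / drift" for m
  proof -
    have "prob {w \<in> space M. walk k w < L'} \<le> expectation (\<lambda>w. window L' 0 (walk k w))" for k
    proof -
      have "prob {w \<in> space M. walk k w < L'} = expectation (indicator {w \<in> space M. walk k w < L'})"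
        by simp
      also have "\<dots> \<le> expectation (\<lambda>w. window L' 0 (walk k w))"
      proof (rule integral_mono_AE)
        show "AE w in M. indicat_real {w \<in> space M. walk k w < L'} w \<le> window L' 0 (walk k w)"
          using AE_all_pos
          by eventually_elim (auto simp: window_def indicator_def walk_nonneg)
      qed (auto intro!: integrable_const_bound[where B = 1] simp: window_bounds)
      finally show ?thesis .
    qed
    then have "(\<Sum>k<m. prob {w \<in> space M. walk k w < L'})
        \<le> (\<Sum>k<m. expectation (\<lambda>w. window L' 0 (walk k w)))"
      by (rule sum_mono)
    also have "\<dots> \<le> (2 + L') / drift"
      using expected_window_sum[of 0 L' m] by (simp add: L'_def)
    finally show ?thesis .
  qed
  then have "summable (\<lambda>k. prob {w \<in> space M. walk k w < L'})"
    by (intro summableI_nonneg_bounded) auto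
  then have "AE w in M. eventually (\<lambda>k. w \<in> space M - {w \<in> space M. walk k w < L'}) sequentially"
    by (intro borel_cantelli_AE1) (auto simp: emeasure_eq_measure)
  then show ?thesis
  proof eventually_elim
    case (elim w)
    then have "\<forall>\<^sub>F k in cofinite. \<not> walk k w < L'"
      unfolding cofinite_eq_sequentially by eventually_elim auto
    then have "finite {k. walk k w < L'}" by (simp add: eventually_cofinite)
    then show ?case by (rule finite_subset[rotated]) (auto simp: L'_def)
  qed
qed

text \<open>
  The duality between a renewal process and its walk, which turns the central limit theorem for the
  walk into one for the number of renewals.
\<close>

lemma AE_renewals_le_iff: "AE w in M. \<forall>k. renewals L w \<le> k \<longleftrightarrow> L \<le> walk k w"
  using AE_finite_renewals[of L] AE_all_pos
proof eventually_elim
  case (elim w)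
  let ?A = "{k. walk k w < L}"
  have mono: "walk j w \<le> walk k w" if "j \<le> k" for j k
    using that elim(2) unfolding walk_def by (intro sum_mono2) (auto intro: less_imp_le)
  show ?case
  proof (intro allI iffI)
    fix k assume le: "renewals L w \<le> k"
    show "L \<le> walk k w"
    proof (rule ccontr)
      assume "\<not> L \<le> walk k w"
      then have "{..k} \<subseteq> ?A" using mono by (force intro: le_less_trans)
      from card_mono[OF elim(1) this] show False using le by (simp add: renewals_def)
    qed
  next
    fix k assume "L \<le> walk k w"
    then have "?A \<subseteq> {..<k}" using mono by (force simp: not_le[symmetric])
    from card_mono[OF _ this] show "renewals L w \<le> k" by (simp add: renewals_def)
  qed
qed

text \<open>
  The classical central limit theorem applied to \<open>- \<xi>\<close>. The sign makes the event one of the form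
  \<open>L \<le> walk k w\<close>, which is what the duality of \<open>renewals\<close> and \<open>walk\<close> asks for.
\<close>

lemma reversed_walk_clt:
  assumes sq: "integrable M (\<lambda>w. (\<xi> 0 w)\<^sup>2)"
    and \<mu>: "\<mu> = expectation (\<xi> 0)"
    and \<sigma>: "0 < \<sigma>" "\<sigma>\<^sup>2 = variance (\<xi> 0)"
  shows "(\<lambda>k. prob {w \<in> space M. (real k * \<mu> - walk k w) / (\<sigma> * sqrt (real k)) \<le> y})
      \<longlonglongrightarrow> cdf std_normal_distribution y"
proof -
  define \<eta> where "\<eta> i w = - \<xi> i w" for i w
  have transfer_distr: "distr M borel (\<lambda>w. f (\<xi> i w)) = distr M borel (\<lambda>w. f (\<xi> 0 w))"
    if [measurable]: "f \<in> borel_measurable borel" for f :: "real \<Rightarrow> real" and i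
  proof -
    have "distr M borel (\<lambda>w. f (\<xi> j w)) = distr \<rho> borel f" for j
      by (subst ident[of j, symmetric], subst distr_distr) (auto simp: comp_def)
    then show ?thesis by simp
  qed
  have transfer_integral: "expectation (\<lambda>w. f (\<xi> i w)) = expectation (\<lambda>w. f (\<xi> 0 w))"
    if "f \<in> borel_measurable borel" for f :: "real \<Rightarrow> real" and i
    using arg_cong[OF transfer_distr[OF that, of i], of "\<lambda>N. integral\<^sup>L N (\<lambda>x. x)"] that
    by (simp add: integral_distr)
  have transfer_integrable: "integrable M (\<lambda>w. f (\<xi> i w)) \<longleftrightarrow> integrable M (\<lambda>w. f (\<xi> 0 w))"
    if "f \<in> borel_measurable borel" for f :: "real \<Rightarrow> real" and i
    using arg_cong[OF transfer_distr[OF that, of i], of "\<lambda>N. integrable N (\<lambda>x. x)"] that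
    by (simp add: integrable_distr_eq)
  have "weak_conv_m (\<lambda>n. distr M borel (\<lambda>w. (\<Sum>i<n. \<eta> i w - (- \<mu>)) / sqrt (real n * \<sigma>\<^sup>2)))
      std_normal_distribution"
  proof (rule central_limit_theorem)
    show "indep_vars (\<lambda>_. borel) \<eta> UNIV"
      unfolding \<eta>_def[abs_def] by (rule indep_vars_compose2[OF indep]) auto
    have mean: "expectation (\<eta> i) = - \<mu>" for i
      using transfer_integral[of "\<lambda>x. - x" i] by (simp add: \<eta>_def[abs_def] \<mu>)
    then show "expectation (\<eta> i) = - \<mu>" for i .
    show "0 < \<sigma>" by fact
    show "integrable M (\<lambda>w. (\<eta> i w)\<^sup>2)" for i
      using transfer_integrable[of "\<lambda>x. x\<^sup>2" i] sq by (simp add: \<eta>_def)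
    show "variance (\<eta> i) = \<sigma>\<^sup>2" for i
      using transfer_integral[of "\<lambda>x. (- x + \<mu>)\<^sup>2" i] unfolding mean
      by (simp add: \<eta>_def \<sigma>(2) \<mu>[symmetric] power2_commute)
    show "distr M borel (\<eta> i) = distr M borel (\<eta> 0)" for i
      using transfer_distr[of uminus i] by (simp add: \<eta>_def[abs_def])
  qed
  then have "(\<lambda>n. cdf (distr M borel (\<lambda>w. (\<Sum>i<n. \<eta> i w - (- \<mu>)) / sqrt (real n * \<sigma>\<^sup>2))) y)
      \<longlonglongrightarrow> cdf std_normal_distribution y"
    using isCont_cdf_std_normal by (simp add: weak_conv_m_def weak_conv_def)
  moreover have "cdf (distr M borel (\<lambda>w. (\<Sum>i<n. \<eta> i w - (- \<mu>)) / sqrt (real n * \<sigma>\<^sup>2))) y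
      = prob {w \<in> space M. (real n * \<mu> - walk n w) / (\<sigma> * sqrt (real n)) \<le> y}" for n
  proof -
    have "(\<Sum>i<n. \<eta> i w - (- \<mu>)) / sqrt (real n * \<sigma>\<^sup>2)
        = (real n * \<mu> - walk n w) / (\<sigma> * sqrt (real n))" for w
      using \<sigma>(1) by (simp add: \<eta>_def walk_def sum_subtractf real_sqrt_mult mult.commute)
    then show ?thesis
      by (simp add: cdf_def measure_distr vimage_def Int_def conj_commute)
  qed
  ultimately show ?thesis by simp
qed

text \<open>
  By duality, \<open>renewals L w \<le> t\<close> for \<open>t = L / \<mu> + x c sqrt L\<close> is the event \<open>L \<le> walk k w\<close> with
  \<open>k = floor t\<close>. In the normalization of the central limit theorem the threshold becomes
  \<open>(k \<mu> - L) / (\<sigma> sqrt k)\<close>, which tends to \<open>x\<close> because \<open>k\<close> is asymptotic to \<open>L / \<mu>\<close> and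
  \<open>c = \<sigma> \<mu> powr (- 3 / 2)\<close>.
\<close>

theorem renewal_clt:
  assumes sq: "integrable M (\<lambda>w. (\<xi> 0 w)\<^sup>2)"
    and \<mu>: "\<mu> = expectation (\<xi> 0)" "0 < \<mu>"
    and \<sigma>: "0 < \<sigma>" "\<sigma>\<^sup>2 = variance (\<xi> 0)"
  shows "((\<lambda>L. prob {w \<in> space M. (real (renewals L w) - inverse \<mu> * L) /
            (\<sigma> * \<mu> powr (- 3 / 2) * sqrt L) \<le> x}) \<longlongrightarrow> cdf std_normal_distribution x) at_top"
proof -
  define c where "c = \<sigma> * \<mu> powr (- 3 / 2)"
  have "c > 0" using \<mu> \<sigma> by (simp add: c_def)
  define t where "t L = inverse \<mu> * L + x * c * sqrt L" for L
  define k where "k L = nat \<lfloor>t L\<rfloor>" for L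
  define y where "y L = (real (k L) * \<mu> - L) / (\<sigma> * sqrt (real (k L)))" for L
  have t_top: "filterlim t at_top at_top"
    unfolding t_def using \<mu>(2) by real_asymp
  then have k_top: "filterlim k sequentially at_top"
    unfolding k_def
    by (intro filterlim_compose[OF filterlim_nat_sequentially]
              filterlim_compose[OF filterlim_floor_sequentially])
  have ev: "\<forall>\<^sub>F L in at_top. t L \<ge> 1 \<and> L > 0"
    using t_top eventually_gt_at_top[of 0] by (auto simp: filterlim_at_top intro: eventually_conj)
  \<comment> \<open>The rounding error is bounded, hence negligible against \<open>L\<close> and against \<open>sqrt L\<close>.\<close>
  define \<theta> where "\<theta> L = t L - real (k L)" for L
  have \<theta>: "\<forall>\<^sub>F L in at_top. 0 \<le> \<theta> L \<and> \<theta> L \<le> 1"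
    using ev by eventually_elim (auto simp: \<theta>_def k_def, linarith+)
  have \<theta>_small: "((\<lambda>L. \<theta> L / f L) \<longlongrightarrow> 0) at_top"
    if f: "((\<lambda>L. 1 / f L) \<longlongrightarrow> 0) at_top" for f :: "real \<Rightarrow> real"
  proof (rule Lim_null_comparison)
    show "\<forall>\<^sub>F L in at_top. norm (\<theta> L / f L) \<le> \<bar>1 / f L\<bar>"
      using \<theta> by eventually_elim (auto simp: divide_right_mono)
    show "((\<lambda>L. \<bar>1 / f L\<bar>) \<longlongrightarrow> 0) at_top" using tendsto_rabs_zero[OF f] .
  qed
  have ratio: "((\<lambda>L. real (k L) / L) \<longlongrightarrow> inverse \<mu>) at_top"
  proof -
    have "((\<lambda>L. t L / L - \<theta> L / L) \<longlongrightarrow> inverse \<mu> - 0) at_top"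
    proof (intro tendsto_diff \<theta>_small)
      show "((\<lambda>L. t L / L) \<longlongrightarrow> inverse \<mu>) at_top" unfolding t_def by real_asymp
      show "((\<lambda>L::real. 1 / L) \<longlongrightarrow> 0) at_top" by real_asymp
    qed
    then show ?thesis by (simp add: \<theta>_def diff_divide_distrib)
  qed
  have "((\<lambda>L. (\<mu> * x * c - \<mu> * (\<theta> L / sqrt L)) / (\<sigma> * sqrt (real (k L) / L)))
      \<longlongrightarrow> (\<mu> * x * c - \<mu> * 0) / (\<sigma> * sqrt (inverse \<mu>))) at_top"
  proof (intro tendsto_intros \<theta>_small ratio)
    show "((\<lambda>L. 1 / sqrt L) \<longlongrightarrow> 0) at_top" by real_asymp
    show "\<sigma> * sqrt (inverse \<mu>) \<noteq> 0" using \<mu> \<sigma> by simp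
  qed
  also have "(\<mu> * x * c - \<mu> * 0) / (\<sigma> * sqrt (inverse \<mu>)) = x"
  proof -
    have "sqrt (inverse \<mu>) = \<mu> powr (- 1 / 2)"
      using \<mu>(2) by (simp add: powr_minus powr_half_sqrt real_sqrt_inverse)
    moreover have "\<mu> * \<mu> powr (- 3 / 2) = \<mu> powr (- 1 / 2)"
      using \<mu>(2) powr_add[of \<mu> 1 "- 3 / 2"] by simp
    moreover have "(\<mu> * x * c - \<mu> * 0) / (\<sigma> * sqrt (inverse \<mu>))
        = x * (\<mu> * \<mu> powr (- 3 / 2)) / sqrt (inverse \<mu>)"
      using \<sigma>(1) by (simp add: c_def)
    ultimately show ?thesis using \<mu>(2) by simp
  qed
  finally have y_lim: "(y \<longlongrightarrow> x) at_top"
  proof (rule Lim_transform_eventually)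
    show "\<forall>\<^sub>F L in at_top. (\<mu> * x * c - \<mu> * (\<theta> L / sqrt L)) / (\<sigma> * sqrt (real (k L) / L)) = y L"
      using ev
    proof eventually_elim
      case (elim L)
      have "real (k L) * \<mu> - L = sqrt L * (\<mu> * x * c - \<mu> * (\<theta> L / sqrt L))"
        using elim \<mu>(2) by (simp add: \<theta>_def t_def field_simps)
      then show ?case using elim by (simp add: y_def real_sqrt_divide)
    qed
  qed
  have "((\<lambda>L. prob {w \<in> space M. (real (k L) * \<mu> - walk (k L) w) / (\<sigma> * sqrt (real (k L))) \<le> y L})
      \<longlongrightarrow> cdf std_normal_distribution x) at_top"
  proof (rule monotone_continuous_convergence[where
        F = "\<lambda>k y. prob {w \<in> space M. (real k * \<mu> - walk k w) / (\<sigma> * sqrt (real k)) \<le> y}"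
        and \<Phi> = "cdf std_normal_distribution"])
    show "mono (\<lambda>y. prob {w \<in> space M. (real k * \<mu> - walk k w) / (\<sigma> * sqrt (real k)) \<le> y})" for k
      by (intro monoI finite_measure_mono) auto
  qed (use reversed_walk_clt[OF sq \<mu>(1) \<sigma>] isCont_cdf_std_normal k_top y_lim in auto)
  then show ?thesis
  proof (rule Lim_transform_eventually)
    show "\<forall>\<^sub>F L in at_top.
        prob {w \<in> space M. (real (k L) * \<mu> - walk (k L) w) / (\<sigma> * sqrt (real (k L))) \<le> y L}
        = prob {w \<in> space M. (real (renewals L w) - inverse \<mu> * L) /
            (\<sigma> * \<mu> powr (- 3 / 2) * sqrt L) \<le> x}"
      using ev
    proof eventually_elim
      case (elim L)
      have "1 \<le> k L" using elim by (simp add: k_def le_nat_floor)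
      have lhs: "(real (k L) * \<mu> - s) / (\<sigma> * sqrt (real (k L))) \<le> y L \<longleftrightarrow> L \<le> s" for s
        using \<open>1 \<le> k L\<close> \<sigma>(1) by (simp add: y_def divide_le_cancel mult_less_0_iff)
      have rhs: "(real N - inverse \<mu> * L) / (\<sigma> * \<mu> powr (- 3 / 2) * sqrt L) \<le> x \<longleftrightarrow> N \<le> k L" for N
      proof -
        have "(real N - inverse \<mu> * L) / (c * sqrt L) \<le> x \<longleftrightarrow> real N \<le> t L"
          using \<open>c > 0\<close> elim by (simp add: t_def pos_divide_le_eq algebra_simps)
        also have "\<dots> \<longleftrightarrow> N \<le> k L"
          using elim by (simp add: k_def le_nat_iff le_floor_iff)
        finally show ?thesis by (simp add: c_def)
      qed
      show ?case unfolding lhs rhs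
        using AE_renewals_le_iff[of L] by (intro finite_measure_eq_AE) auto
    qed
  qed
qed

end

section \<open>Occupied intervals of the Bernoulli sieve\<close>

text \<open>
  In the logarithmic scale \<open>t = - ln (1 - p)\<close> the points \<open>P\<^sub>k\<close> become the positions of a walk with
  steps \<open>- ln (1 - X i)\<close>, and \<open>p = 1 - 1 / n\<close> becomes \<open>t = ln n\<close>.
\<close>

locale bernoulli_sieve = prob_space +
  fixes X U :: "nat \<Rightarrow> 'a \<Rightarrow> real" and \<omega> :: "real measure"
  assumes X_indep: "indep_vars (\<lambda>_. borel) X UNIV"
    and X_distr: "\<And>i. distr M borel (X i) = \<omega>"
    and X_unit: "\<And>i. AE w in M. 0 < X i w \<and> X i w < 1"
    and U_indep: "indep_vars (\<lambda>_. borel) U UNIV"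
    and U_distr: "\<And>i. distr M borel (U i) = uniform_measure lborel {0..1}"
    and X_U_indep: "indep_var (\<Pi>\<^sub>M i\<in>UNIV. borel) (\<lambda>w i. X i w) (\<Pi>\<^sub>M i\<in>UNIV. borel) (\<lambda>w i. U i w)"
begin

lemma X_measurable [measurable]: "X i \<in> borel_measurable M"
  using X_indep by (auto simp: indep_vars_def2)

lemma U_measurable [measurable]: "U i \<in> borel_measurable M"
  using U_indep by (auto simp: indep_vars_def2)

sublocale renewal_walk M "\<lambda>i w. - ln (1 - X i w)" "distr \<omega> borel (\<lambda>x. - ln (1 - x))"
proof
  show "indep_vars (\<lambda>_. borel) (\<lambda>i w. - ln (1 - X i w)) UNIV"
    by (rule indep_vars_compose2[OF X_indep]) auto
  show "distr M borel (\<lambda>w. - ln (1 - X i w)) = distr \<omega> borel (\<lambda>x. - ln (1 - x))" for i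
    by (subst X_distr[of i, symmetric], subst distr_distr) (auto simp: comp_def)
  show "AE w in M. 0 < - ln (1 - X i w)" for i
    using X_unit[of i] by eventually_elim simp
qed

lemma AE_X_unit: "AE w in M. \<forall>i. 0 < X i w \<and> X i w < 1"
  using X_unit by (simp add: AE_all_countable)

lemma sieve_point_measurable [measurable]: "sieve_point X k \<in> borel_measurable M"
  unfolding sieve_point_def[abs_def] by measurable

lemma occupied_count_measurable [measurable]:
  "occupied_count X U n \<in> measurable M (count_space UNIV)"
  unfolding occupied_count_def[abs_def] greaterThanLessThan_iff by measurable

lemma sieve_point_eq_walk:
  assumes "\<And>i. 0 < X i w \<and> X i w < 1"
  shows "sieve_point X k w = 1 - exp (- walk k w)"
proof -
  have "exp (- walk k w) = (\<Prod>i<k. exp (ln (1 - X i w)))"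
    by (simp add: walk_def sum_negf exp_sum)
  also have "\<dots> = (\<Prod>i<k. 1 - X i w)"
    using assms by (intro prod.cong) auto
  finally show ?thesis by (simp add: sieve_point_def)
qed

lemma sieve_gap:
  assumes "\<And>i. 0 < X i w \<and> X i w < 1"
  shows "sieve_point X (Suc k) w - sieve_point X k w = exp (- walk k w) * X k w"
  using sieve_point_eq_walk[OF assms, of k] by (simp add: sieve_point_def algebra_simps)

lemma sieve_point_mono:
  assumes "\<And>i. 0 < X i w \<and> X i w < 1" "j \<le> k"
  shows "sieve_point X j w \<le> sieve_point X k w"
  using assms(2)
proof (rule lift_Suc_mono_le[rotated])
  fix i
  have "0 \<le> exp (- walk i w) * X i w" using assms(1)[of i] by simp
  then show "sieve_point X i w \<le> sieve_point X (Suc i) w"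
    using sieve_gap[OF assms(1), of i] by linarith
qed

lemma sieve_point_bounds:
  assumes "\<And>i. 0 < X i w \<and> X i w < 1"
  shows "0 \<le> sieve_point X k w" "sieve_point X k w \<le> 1"
  using sieve_point_mono[OF assms, of 0 k]
  by (auto simp: sieve_point_eq_walk[OF assms]) (simp add: walk_def)

lemma prob_U:
  assumes [measurable]: "A \<in> sets borel"
  shows "prob (U i -` A \<inter> space M) = measure lborel ({0..1} \<inter> A)"
proof -
  have "prob (U i -` A \<inter> space M) = measure (distr M borel (U i)) A"
    by (subst measure_distr) auto
  also have "\<dots> = measure lborel ({0..1} \<inter> A)"
    unfolding U_distr by (subst measure_uniform_measure) auto
  finally show ?thesis .
qed

lemma prob_interval_missed:
  assumes "0 \<le> a" "a \<le> b" "b \<le> 1"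
  shows "prob {w \<in> space M. \<forall>i<n. U i w \<notin> {a<..<b}} = (1 - (b - a)) ^ n"
proof (cases "n = 0")
  case True
  then show ?thesis by (simp add: prob_space)
next
  case False
  have hit: "prob (U i -` {a<..<b} \<inter> space M) = b - a" for i
  proof -
    have "{0..1} \<inter> {a<..<b} = {a<..<b}" using assms by auto
    then show ?thesis using assms by (subst prob_U) auto
  qed
  have miss: "prob (U i -` (- {a<..<b}) \<inter> space M) = 1 - (b - a)" for i
  proof -
    have "U i -` (- {a<..<b}) \<inter> space M = space M - (U i -` {a<..<b} \<inter> space M)" by auto
    then show ?thesis using hit[of i] by (simp add: prob_compl)
  qed
  have "{w \<in> space M. \<forall>i<n. U i w \<notin> {a<..<b}} = (\<Inter>i\<in>{..<n}. U i -` (- {a<..<b}) \<inter> space M)"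
    using False by auto
  then have "prob {w \<in> space M. \<forall>i<n. U i w \<notin> {a<..<b}}
      = (\<Prod>i<n. prob (U i -` (- {a<..<b}) \<inter> space M))"
    using indep_varsD[OF U_indep, of "{..<n}" "\<lambda>_. - {a<..<b}"] False by auto
  then show ?thesis by (simp add: miss)
qed

text \<open>
  From \<open>(1 - d) ^ n \<le> exp (- n d)\<close> and \<open>n d \<le> exp (n d)\<close>.
\<close>

lemma prob_interval_missed_le:
  assumes "0 \<le> a" "a < b" "b \<le> 1" "0 < n"
  shows "prob {w \<in> space M. \<forall>i<n. U i w \<notin> {a<..<b}} \<le> min 1 (1 / (real n * (b - a)))"
proof -
  have "1 - (b - a) \<le> exp (- (b - a))"
    using exp_ge_add_one_self[of "- (b - a)"] by linarith
  then have "(1 - (b - a)) ^ n \<le> exp (- (b - a)) ^ n"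
    using assms by (intro power_mono) auto
  also have "\<dots> = inverse (exp (real n * (b - a)))"
    by (simp add: exp_of_nat_mult[symmetric] exp_minus[symmetric] algebra_simps)
  also have "\<dots> \<le> inverse (real n * (b - a))"
  proof (rule le_imp_inverse_le)
    show "real n * (b - a) \<le> exp (real n * (b - a))"
      using exp_ge_add_one_self[of "real n * (b - a)"] by linarith
    show "0 < real n * (b - a)" using assms by simp
  qed
  also have "(1 - (b - a)) ^ n = prob {w \<in> space M. \<forall>i<n. U i w \<notin> {a<..<b}}"
    using assms by (intro prob_interval_missed[symmetric]) auto
  finally show ?thesis
    by (intro min.boundedI prob_le_1) (simp only: inverse_eq_divide)
qed

definition empty_gap :: "nat \<Rightarrow> nat \<Rightarrow> 'a \<Rightarrow> bool" where
  "empty_gap n k w \<longleftrightarrow> (\<forall>i<n. U i w \<notin> {sieve_point X k w <..< sieve_point X (Suc k) w})"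

lemma empty_gap_measurable [measurable]: "Measurable.pred M (empty_gap n k)"
  unfolding empty_gap_def[abs_def] greaterThanLessThan_iff by measurable

text \<open>
  Integrating over the points first, with the intervals held fixed, leaves the bound on the
  probability of missing an interval; the interval has length \<open>exp (- walk k w) * X k w\<close>, and for that
  length the bound is the window with parameter \<open>ln n + ln (X k w)\<close>.
\<close>

lemma prob_empty_gap_le:
  assumes "0 < n"
  shows "emeasure M {w \<in> space M. walk k w < ln (real n) \<and> empty_gap n k w}
    \<le> (\<integral>\<^sup>+w. ennreal (window (ln n) (ln n + ln (X k w)) (walk k w)) \<partial>M)"
proof -
  let ?P = "\<Pi>\<^sub>M i\<in>UNIV. (borel :: real measure)"
  \<comment> \<open>The same points as functions on the sequence space, so that the event becomes a measurable set
    of pairs of sequences.\<close>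
  define s where "s k x = sieve_point (\<lambda>i x. x i) k x" for k and x :: "nat \<Rightarrow> real"
  have [measurable]: "s k \<in> borel_measurable ?P" for k
    unfolding s_def[abs_def] sieve_point_def[abs_def] by measurable
  have s_X: "s k (\<lambda>i. X i w) = sieve_point X k w" for k w
    by (simp add: s_def sieve_point_def)
  define f :: "(nat \<Rightarrow> real) \<times> (nat \<Rightarrow> real) \<Rightarrow> ennreal" where
    "f p = indicator {p. (\<Sum>i<k. - ln (1 - fst p i)) < ln n \<and>
        (\<forall>i<n. \<not> (s k (fst p) < snd p i \<and> snd p i < s (Suc k) (fst p)))} p" for p
  have [measurable]: "f \<in> borel_measurable (?P \<Otimes>\<^sub>M ?P)"
    unfolding f_def[abs_def] by measurable
  have f_eq: "f (\<lambda>i. X i v, \<lambda>i. U i w) = indicator {..<ln n} (walk k v) *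
      indicator {w. \<forall>i<n. U i w \<notin> {sieve_point X k v <..< sieve_point X (Suc k) v}} w" for v w
    by (auto simp: f_def s_X walk_def indicator_def)
  have "emeasure M {w \<in> space M. walk k w < ln (real n) \<and> empty_gap n k w}
      = (\<integral>\<^sup>+w. f (\<lambda>i. X i w, \<lambda>i. U i w) \<partial>M)"
  proof -
    have "emeasure M {w \<in> space M. walk k w < ln (real n) \<and> empty_gap n k w}
        = (\<integral>\<^sup>+w. indicator {w \<in> space M. walk k w < ln (real n) \<and> empty_gap n k w} w \<partial>M)"
      by (rule nn_integral_indicator[symmetric]) measurable
    also have "\<dots> = (\<integral>\<^sup>+w. f (\<lambda>i. X i w, \<lambda>i. U i w) \<partial>M)"
      unfolding f_eq by (intro nn_integral_cong) (auto simp: indicator_def empty_gap_def)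
    finally show ?thesis .
  qed
  also have "\<dots> = (\<integral>\<^sup>+v. \<integral>\<^sup>+w. f (\<lambda>i. X i v, \<lambda>i. U i w) \<partial>M \<partial>M)"
    by (rule nn_integral_decouple[OF X_U_indep]) measurable
  also have "\<dots> \<le> (\<integral>\<^sup>+v. ennreal (window (ln n) (ln n + ln (X k v)) (walk k v)) \<partial>M)"
  proof (rule nn_integral_mono_AE)
    show "AE v in M. (\<integral>\<^sup>+w. f (\<lambda>i. X i v, \<lambda>i. U i w) \<partial>M)
        \<le> ennreal (window (ln n) (ln n + ln (X k v)) (walk k v))"
      using AE_X_unit
    proof eventually_elim
      case (elim v)
      then have unit: "\<And>i. 0 < X i v \<and> X i v < 1" by auto
      let ?a = "sieve_point X k v" and ?b = "sieve_point X (Suc k) v"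
      have gap: "?b - ?a = exp (- walk k v) * X k v" by (rule sieve_gap[OF unit])
      moreover have "0 < exp (- walk k v) * X k v" using unit[of k] by simp
      ultimately have "?a < ?b" by linarith
      let ?miss = "{w \<in> space M. \<forall>i<n. U i w \<notin> {?a<..<?b}}"
      have miss: "?miss \<in> sets M"
        unfolding greaterThanLessThan_iff by measurable
      have "(\<integral>\<^sup>+w. f (\<lambda>i. X i v, \<lambda>i. U i w) \<partial>M)
          = (\<integral>\<^sup>+w. indicator {..<ln n} (walk k v) * indicator ?miss w \<partial>M)"
        unfolding f_eq by (rule nn_integral_cong) (simp add: indicator_def)
      also have "\<dots> = indicator {..<ln n} (walk k v) * emeasure M ?miss"
        by (rule nn_integral_cmult_indicator[OF miss])
      also have "\<dots> \<le> indicator {..<ln n} (walk k v) * ennreal (min 1 (1 / (real n * (?b - ?a))))"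
        using prob_interval_missed_le[OF sieve_point_bounds(1)[OF unit] \<open>?a < ?b\<close>
            sieve_point_bounds(2)[OF unit] assms]
        by (intro mult_left_mono) (auto simp: emeasure_eq_measure intro: ennreal_leI)
      also have "1 / (real n * (?b - ?a)) = exp (walk k v - (ln n + ln (X k v)))"
        using unit[of k] assms
        by (simp add: gap exp_diff exp_add exp_minus divide_simps mult_ac)
      also have "indicator {..<ln n} (walk k v) * ennreal (min 1 \<dots>)
          = ennreal (window (ln n) (ln n + ln (X k v)) (walk k v))"
        by (auto simp: window_def indicator_def)
      finally show ?case .
    qed
  qed
  finally show ?thesis .
qed

text \<open>
  The bound does not depend on \<open>n\<close>: in the renewal estimate the parameter is
  \<open>A = ln n + ln (X k w)\<close>, so \<open>L = ln n\<close> cancels in \<open>2 + L - A\<close>. Its finiteness is what the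
  integrability of \<open>ln x\<close> is for.
\<close>

lemma expected_empty_gaps:
  assumes "0 < n"
  shows "(\<integral>\<^sup>+w. of_nat (card {k. walk k w < ln (real n) \<and> empty_gap n k w}) \<partial>M)
    \<le> (\<integral>\<^sup>+w. ennreal ((2 + \<bar>ln (X 0 w)\<bar>) / drift) \<partial>M)"
proof -
  let ?L = "ln (real n)"
  \<comment> \<open>The factor \<open>X k w\<close> recovered from the step \<open>- ln (1 - X k w)\<close> of the walk.\<close>
  define a where "a x = ?L + ln (1 - exp (- x))" for x :: real
  have a_X: "AE w in M. a (- ln (1 - X k w)) = ?L + ln (X k w)" for k
    using X_unit[of k] by eventually_elim (simp add: a_def)
  have "(\<integral>\<^sup>+w. of_nat (card {k. walk k w < ?L \<and> empty_gap n k w}) \<partial>M)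
      = (\<integral>\<^sup>+w. of_nat (card {k. w \<in> {w \<in> space M. walk k w < ?L \<and> empty_gap n k w}}) \<partial>M)"
    by (intro nn_integral_cong) simp
  also have "\<dots> \<le> (\<Sum>k. emeasure M {w \<in> space M. walk k w < ?L \<and> empty_gap n k w})"
    by (rule nn_integral_card_le) measurable
  also have "\<dots> \<le> (\<Sum>k. \<integral>\<^sup>+w. ennreal (window ?L (?L + ln (X k w)) (walk k w)) \<partial>M)"
    by (intro suminf_le prob_empty_gap_le assms) auto
  also have "\<dots> = (\<Sum>k. \<integral>\<^sup>+w. ennreal (window ?L (a (- ln (1 - X k w))) (walk k w)) \<partial>M)"
  proof (intro arg_cong[where f = suminf] ext nn_integral_cong_AE)
    fix k
    show "AE w in M. ennreal (window ?L (?L + ln (X k w)) (walk k w))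
        = ennreal (window ?L (a (- ln (1 - X k w))) (walk k w))"
      using a_X[of k] by eventually_elim simp
  qed
  also have "\<dots> \<le> (\<integral>\<^sup>+w. ennreal ((2 + ?L - a (- ln (1 - X 0 w))) / drift) \<partial>M)"
  proof (rule expected_decoupled_window_sum)
    show "a \<in> borel_measurable borel" unfolding a_def[abs_def] by measurable
    show "a x \<le> ?L" if "x > 0" for x
      using that by (simp add: a_def)
  qed
  also have "\<dots> \<le> (\<integral>\<^sup>+w. ennreal ((2 + \<bar>ln (X 0 w)\<bar>) / drift) \<partial>M)"
  proof (rule nn_integral_mono_AE)
    show "AE w in M. ennreal ((2 + ?L - a (- ln (1 - X 0 w))) / drift)
        \<le> ennreal ((2 + \<bar>ln (X 0 w)\<bar>) / drift)"
      using a_X[of 0] by eventually_elim (use drift_pos in \<open>auto intro!: ennreal_leI divide_right_mono\<close>)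
  qed
  finally show ?thesis .
qed

lemma expected_late_points:
  assumes "0 < n"
  shows "(\<integral>\<^sup>+w. of_nat (card {i. i < n \<and> 1 - 1 / real n < U i w}) \<partial>M) \<le> 1"
proof -
  have late: "emeasure M {w \<in> space M. i < n \<and> 1 - 1 / real n < U i w}
      = (if i < n then ennreal (1 / real n) else 0)" for i
  proof (cases "i < n")
    case True
    have "0 \<le> 1 - 1 / real n" using assms by simp
    then have "{0..1} \<inter> {1 - 1 / real n<..} = {1 - 1 / real n <.. 1}" by auto
    then have "prob (U i -` {1 - 1 / real n<..} \<inter> space M) = 1 / real n"
      by (subst prob_U) auto
    moreover have "U i -` {1 - 1 / real n<..} \<inter> space M = {w \<in> space M. 1 - 1 / real n < U i w}"
      by auto
    ultimately show ?thesis using True by (simp add: emeasure_eq_measure)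
  qed simp
  have "(\<integral>\<^sup>+w. of_nat (card {i. i < n \<and> 1 - 1 / real n < U i w}) \<partial>M)
      = (\<integral>\<^sup>+w. of_nat (card {i. w \<in> {w \<in> space M. i < n \<and> 1 - 1 / real n < U i w}}) \<partial>M)"
    by (intro nn_integral_cong) simp
  also have "\<dots> \<le> (\<Sum>i. emeasure M {w \<in> space M. i < n \<and> 1 - 1 / real n < U i w})"
    by (rule nn_integral_card_le) measurable
  also have "\<dots> = (\<Sum>i\<in>{..<n}. ennreal (1 / real n))"
    unfolding late by (subst suminf_finite[where N = "{..<n}"]) auto
  also have "\<dots> = 1"
    using assms by (simp add: ennreal_of_nat_eq_real_of_nat ennreal_mult[symmetric])
  finally show ?thesis .
qed

text \<open>
  An occupied interval that starts at or beyond \<open>1 - 1 / n\<close> uses up a point of its own in the last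
  stretch of length \<open>1 / n\<close>; an interval that starts before is counted by \<open>renewals\<close>, and it is either
  occupied or an empty gap.
\<close>

lemma occupied_count_near_renewals:
  assumes unit: "\<And>i. 0 < X i w \<and> X i w < 1"
    and fin: "finite {k. walk k w < ln (real n)}" and "0 < n"
  shows "\<bar>real (occupied_count X U n w) - real (renewals (ln (real n)) w)\<bar>
    \<le> real (card {k. walk k w < ln (real n) \<and> empty_gap n k w})
      + real (card {i. i < n \<and> 1 - 1 / real n < U i w})"
proof -
  let ?L = "ln (real n)"
  define hit where "hit i k \<longleftrightarrow> U i w \<in> {sieve_point X k w <..< sieve_point X (Suc k) w}" for i k
  define Occ where "Occ = {k. \<exists>i\<in>{..<n}. hit i k}"
  define Left where "Left = {k. walk k w < ?L}"
  define Empty where "Empty = {k. walk k w < ?L \<and> empty_gap n k w}"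
  define Late where "Late = {i. i < n \<and> 1 - 1 / real n < U i w}"
  have hit_unique: "k = l" if "hit i k" "hit i l" for i k l
  proof (rule ccontr)
    assume "k \<noteq> l"
    then consider "Suc k \<le> l" | "Suc l \<le> k" by linarith
    then show False
      using that sieve_point_mono[OF unit, of "Suc k" l] sieve_point_mono[OF unit, of "Suc l" k]
      by cases (auto simp: hit_def)
  qed
  have Occ_fin: "finite Occ"
    unfolding Occ_def by (rule card_le_labels(1)) (auto intro: hit_unique)
  have occ: "occupied_count X U n w = card Occ"
  proof -
    have "{j. j \<ge> 1 \<and> (\<exists>i<n. U i w \<in> {sieve_point X (j - 1) w <..< sieve_point X j w})} = Suc ` Occ"
    proof (intro set_eqI iffI)
      fix j assume "j \<in> {j. j \<ge> 1 \<and> (\<exists>i<n. U i w \<in> {sieve_point X (j - 1) w <..< sieve_point X j w})}"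
      then show "j \<in> Suc ` Occ"
        by (cases j) (auto simp: Occ_def hit_def)
    qed (auto simp: Occ_def hit_def)
    then show ?thesis by (simp add: occupied_count_def card_image)
  qed
  have "Occ - Left \<subseteq> {k. \<exists>i\<in>Late. hit i k}"
  proof
    fix k assume "k \<in> Occ - Left"
    then obtain i where i: "i < n" "hit i k" and k: "?L \<le> walk k w"
      by (auto simp: Occ_def Left_def)
    have "exp (- walk k w) \<le> exp (- ?L)" using k by simp
    also have "\<dots> = 1 / real n" using \<open>0 < n\<close> by (simp add: exp_minus inverse_eq_divide)
    finally have "1 - 1 / real n \<le> sieve_point X k w"
      by (simp add: sieve_point_eq_walk[OF unit])
    also have "\<dots> < U i w" using i(2) by (simp add: hit_def)
    finally show "k \<in> {k. \<exists>i\<in>Late. hit i k}" using i by (auto simp: Late_def)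
  qed
  moreover have "finite {k. \<exists>i\<in>Late. hit i k}" "card {k. \<exists>i\<in>Late. hit i k} \<le> card Late"
    using card_le_labels[of Late hit] hit_unique by (auto simp: Late_def)
  ultimately have "card (Occ - Left) \<le> card Late"
    using card_mono le_trans by blast
  moreover have "card Occ \<le> card Left + card (Occ - Left)"
  proof -
    have "card Occ \<le> card (Left \<union> (Occ - Left))"
      using fin Occ_fin by (intro card_mono) (auto simp: Left_def)
    then show ?thesis using card_Un_le le_trans by blast
  qed
  moreover have "card Left \<le> card Occ + card Empty"
  proof -
    have "card Left \<le> card (Occ \<union> Empty)"
      using fin Occ_fin
      by (intro card_mono) (auto simp: Left_def Occ_def Empty_def empty_gap_def hit_def)
    then show ?thesis using card_Un_le le_trans by blast
  qed
  ultimately show ?thesis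
    unfolding occ renewals_def Left_def[symmetric] Empty_def[symmetric] Late_def[symmetric]
    by linarith
qed

lemma expected_distance_to_renewals:
  assumes "0 < n"
  shows "(\<integral>\<^sup>+w. ennreal \<bar>real (occupied_count X U n w) - real (renewals (ln (real n)) w)\<bar> \<partial>M)
    \<le> (\<integral>\<^sup>+w. ennreal ((2 + \<bar>ln (X 0 w)\<bar>) / drift) \<partial>M) + 1"
proof -
  let ?E = "\<lambda>w. card {k. walk k w < ln (real n) \<and> empty_gap n k w}"
  let ?R = "\<lambda>w. card {i. i < n \<and> 1 - 1 / real n < U i w}"
  have "(\<integral>\<^sup>+w. ennreal \<bar>real (occupied_count X U n w) - real (renewals (ln (real n)) w)\<bar> \<partial>M)
      \<le> (\<integral>\<^sup>+w. of_nat (?E w) + of_nat (?R w) \<partial>M)"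
  proof (rule nn_integral_mono_AE)
    show "AE w in M. ennreal \<bar>real (occupied_count X U n w) - real (renewals (ln (real n)) w)\<bar>
        \<le> of_nat (?E w) + of_nat (?R w)"
      using AE_X_unit AE_finite_renewals[of "ln (real n)"]
    proof eventually_elim
      case (elim w)
      then show ?case
        using ennreal_leI[OF occupied_count_near_renewals[of w n]] assms
        by (simp add: ennreal_of_nat_eq_real_of_nat)
    qed
  qed
  also have "\<dots> = (\<integral>\<^sup>+w. of_nat (?E w) \<partial>M) + (\<integral>\<^sup>+w. of_nat (?R w) \<partial>M)"
    by (rule nn_integral_add) measurable
  also have "\<dots> \<le> (\<integral>\<^sup>+w. ennreal ((2 + \<bar>ln (X 0 w)\<bar>) / drift) \<partial>M) + 1"
    using expected_empty_gaps[OF assms] expected_late_points[OF assms] by (rule add_mono)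
  finally show ?thesis .
qed

text \<open>
  The number of occupied intervals inherits the limit law of \<open>renewals (ln n)\<close>, as their distance is
  bounded in mean while the scale \<open>\<sigma> \<mu> powr (- 3 / 2) sqrt (ln n)\<close> tends to infinity.
\<close>

theorem occupied_count_clt:
  assumes log_int: "integrable M (\<lambda>w. \<bar>ln (X 0 w)\<bar>)"
    and sq: "integrable M (\<lambda>w. (- ln (1 - X 0 w))\<^sup>2)"
    and \<mu>: "\<mu> = expectation (\<lambda>w. - ln (1 - X 0 w))" "0 < \<mu>"
    and \<sigma>: "0 < \<sigma>" "\<sigma>\<^sup>2 = variance (\<lambda>w. - ln (1 - X 0 w))"
  shows "weak_conv_m
          (\<lambda>n. distr M borel (\<lambda>w.
             (real (occupied_count X U n w) - inverse \<mu> * ln (real n)) /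
             (\<sigma> * \<mu> powr (- 3 / 2) * sqrt (ln (real n)))))
          std_normal_distribution"
proof -
  define scale where "scale n = \<sigma> * \<mu> powr (- 3 / 2) * sqrt (ln (real n))" for n
  define Y where "Y n w = (real (renewals (ln (real n)) w) - inverse \<mu> * ln (real n)) / scale n" for n w
  define Z where "Z n w = (real (occupied_count X U n w) - inverse \<mu> * ln (real n)) / scale n" for n w
  have [measurable]: "Y n \<in> borel_measurable M" "Z n \<in> borel_measurable M" for n
    unfolding Y_def[abs_def] Z_def[abs_def] by measurable
  have scale_top: "filterlim scale at_top sequentially"
  proof -
    have "0 < \<sigma> * \<mu> powr (- 3 / 2)" using \<mu> \<sigma> by simp
    then show ?thesis unfolding scale_def by real_asymp
  qed
  have Y_conv: "(\<lambda>n. prob {w \<in> space M. Y n w \<le> x}) \<longlonglongrightarrow> cdf std_normal_distribution x" for x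
    unfolding Y_def scale_def
    by (rule filterlim_compose[OF renewal_clt[OF sq \<mu> \<sigma>]]) real_asymp
  define C where "C = expectation (\<lambda>w. (2 + \<bar>ln (X 0 w)\<bar>) / drift) + 1"
  have C: "(\<integral>\<^sup>+w. ennreal ((2 + \<bar>ln (X 0 w)\<bar>) / drift) \<partial>M) + 1 = ennreal C"
  proof -
    have "integrable M (\<lambda>w. (2 + \<bar>ln (X 0 w)\<bar>) / drift)" using log_int by simp
    then have "(\<integral>\<^sup>+w. ennreal ((2 + \<bar>ln (X 0 w)\<bar>) / drift) \<partial>M)
        = ennreal (expectation (\<lambda>w. (2 + \<bar>ln (X 0 w)\<bar>) / drift))"
      using drift_pos by (intro nn_integral_eq_integral) auto
    moreover have "0 \<le> expectation (\<lambda>w. (2 + \<bar>ln (X 0 w)\<bar>) / drift)"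
      using drift_pos by (intro Bochner_Integration.integral_nonneg) auto
    ultimately show ?thesis by (simp add: C_def ennreal_plus)
  qed
  have close: "(\<lambda>n. prob {w \<in> space M. \<bar>Z n w - Y n w\<bar> \<ge> e}) \<longlonglongrightarrow> 0" if "e > 0" for e
  proof (rule tendsto_sandwich[OF _ _ tendsto_const])
    show "\<forall>\<^sub>F n in sequentially. 0 \<le> prob {w \<in> space M. \<bar>Z n w - Y n w\<bar> \<ge> e}" by simp
    show "(\<lambda>n. C / (e * scale n)) \<longlonglongrightarrow> 0"
      using that by (intro tendsto_divide_0[OF tendsto_const] filterlim_at_top_imp_at_infinity
          filterlim_tendsto_pos_mult_at_top[OF tendsto_const _ scale_top])
    show "\<forall>\<^sub>F n in sequentially. prob {w \<in> space M. \<bar>Z n w - Y n w\<bar> \<ge> e} \<le> C / (e * scale n)"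
      using filterlim_at_top_dense[THEN iffD1, OF scale_top, rule_format, of 0] eventually_gt_at_top[of 0]
    proof eventually_elim
      case (elim n)
      define D where "D w = \<bar>real (occupied_count X U n w) - real (renewals (ln (real n)) w)\<bar>" for w
      have [measurable]: "D \<in> borel_measurable M" unfolding D_def[abs_def] by measurable
      have D_bound: "(\<integral>\<^sup>+w. ennreal (D w) \<partial>M) \<le> ennreal C"
        using expected_distance_to_renewals[OF elim(2)] by (simp add: C D_def)
      have D_int: "integrable M D"
        using D_bound by (intro integrableI_bounded) (auto simp: D_def intro: le_less_trans)
      have "ennreal (expectation D) \<le> ennreal C"
        using D_bound D_int by (subst nn_integral_eq_integral[symmetric]) (auto simp: D_def)
      moreover have "0 \<le> C"
        unfolding C_def using drift_pos by (intro add_nonneg_nonneg Bochner_Integration.integral_nonneg) auto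
      ultimately have "expectation D \<le> C" by simp
      have eq: "\<bar>Z n w - Y n w\<bar> \<ge> e \<longleftrightarrow> D w \<ge> e * scale n" for w
      proof -
        have "Z n w - Y n w
            = (real (occupied_count X U n w) - real (renewals (ln (real n)) w)) / scale n"
          by (simp add: Z_def Y_def diff_divide_distrib)
        then show ?thesis using elim(1) by (simp add: D_def pos_le_divide_eq)
      qed
      have "prob {w \<in> space M. D w \<ge> e * scale n} \<le> expectation D / (e * scale n)"
        by (rule integral_Markov_inequality_measure[OF D_int, where A = "{}"])
           (use that elim in \<open>auto simp: D_def\<close>)
      also have "\<dots> \<le> C / (e * scale n)"
        using \<open>expectation D \<le> C\<close> that elim by (intro divide_right_mono) auto
      finally show ?case by (simp add: eq)
    qed
  qed
  have "(\<lambda>n. cdf (distr M borel (Z n)) x) \<longlonglongrightarrow> cdf std_normal_distribution x" for x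
  proof -
    have "cdf (distr M borel (Z n)) x = prob {w \<in> space M. Z n w \<le> x}" for n
      by (simp add: cdf_def measure_distr vimage_def Int_def conj_commute)
    then show ?thesis
      using cdf_convergence_perturb[of Y Z, OF _ _ Y_conv isCont_cdf_std_normal close] by simp
  qed
  then show ?thesis
    by (simp add: weak_conv_m_def weak_conv_def Z_def[abs_def] scale_def)
qed

end

section \<open>The limit law for a factor distribution on the unit interval\<close>

theorem proposition7:
  fixes M :: "'a measure"
    and X U :: "nat \<Rightarrow> 'a \<Rightarrow> real"
    and \<omega> :: "real measure"
    and \<mu> \<nu> \<sigma> :: real
  assumes omega_distribution: "real_distribution \<omega>"
    and omega_on_unit_interval: "measure \<omega> {0<..<1} = 1"
    and not_geometric: "\<not> (\<exists>x\<in>{0<..<1::real}. measure \<omega> {1 - x ^ j | j. j \<ge> 1} = 1)"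
    and log_integrable: "integrable \<omega> (\<lambda>x. \<bar>ln x\<bar>)"
    and log_square_integrable: "integrable \<omega> (\<lambda>x. (ln (1 - x))\<^sup>2)"
    and nu: "\<nu> = (LINT x|\<omega>. (ln (1 - x))\<^sup>2)"
    and mu: "\<mu> = (LINT x|\<omega>. \<bar>ln (1 - x)\<bar>)"
    and sigma: "\<sigma> = sqrt (\<nu> - \<mu>\<^sup>2)"
    and M: "prob_space M"
    and X_indep: "prob_space.indep_vars M (\<lambda>_. borel) X UNIV"
    and X_distr: "\<And>i. distr M borel (X i) = \<omega>"
    and U_indep: "prob_space.indep_vars M (\<lambda>_. borel) U UNIV"
    and U_distr: "\<And>i. distr M borel (U i) = uniform_measure lborel {0..1}"
    and X_U_indep: "prob_space.indep_var M
          (\<Pi>\<^sub>M i\<in>UNIV. borel) (\<lambda>w i. X i w) (\<Pi>\<^sub>M i\<in>UNIV. borel) (\<lambda>w i. U i w)"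
  shows "weak_conv_m
          (\<lambda>n. distr M borel (\<lambda>w.
             (real (occupied_count X U n w) - inverse \<mu> * ln (real n)) /
             (\<sigma> * \<mu> powr (- 3 / 2) * sqrt (ln (real n)))))
          std_normal_distribution"
proof -
  interpret prob_space M by fact
  interpret omega: real_distribution \<omega> by fact
  have X_meas [measurable]: "X i \<in> borel_measurable M" for i
    using X_indep by (auto simp: indep_vars_def2)
  have omega_unit: "AE x in \<omega>. 0 < x \<and> x < 1"
    using omega.prob_eq_1[of "{0<..<1}"] omega_on_unit_interval by simp
  have X_unit: "AE w in M. 0 < X i w \<and> X i w < 1" for i
    using omega_unit unfolding X_distr[of i, symmetric] by (subst (asm) AE_distr_iff) auto
  interpret sieve: bernoulli_sieve M X U \<omega>
    by unfold_locales (fact X_indep X_distr X_unit U_indep U_distr X_U_indep)+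
  have integral_X: "expectation (\<lambda>w. f (X 0 w)) = (LINT x|\<omega>. f x)"
    if "f \<in> borel_measurable borel" for f :: "real \<Rightarrow> real"
    using that by (subst X_distr[of 0, symmetric], subst integral_distr) auto
  have integrable_X: "integrable M (\<lambda>w. f (X 0 w)) \<longleftrightarrow> integrable \<omega> f"
    if "f \<in> borel_measurable borel" for f :: "real \<Rightarrow> real"
    using that by (subst X_distr[of 0, symmetric], subst integrable_distr_eq) auto
  have abs_eq: "(LINT x|\<omega>. \<bar>ln (1 - x)\<bar>) = (LINT x|\<omega>. - ln (1 - x))"
  proof (rule integral_cong_AE)
    show "AE x in \<omega>. \<bar>ln (1 - x)\<bar> = - ln (1 - x)"
      using omega_unit by eventually_elim simp
  qed auto
  let ?\<xi> = "\<lambda>w. - ln (1 - X 0 w)"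
  have mean: "\<mu> = expectation ?\<xi>"
    using integral_X[of "\<lambda>x. - ln (1 - x)"] by (simp add: mu abs_eq)
  have sq: "integrable M (\<lambda>w. (?\<xi> w)\<^sup>2)"
    using integrable_X[of "\<lambda>x. (ln (1 - x))\<^sup>2"] log_square_integrable by simp
  have int: "integrable M ?\<xi>"
    by (rule square_integrable_imp_integrable[OF _ sq]) measurable
  have \<xi>_pos: "AE w in M. 0 < ?\<xi> w"
    using X_unit[of 0] by eventually_elim simp
  have "\<mu> \<noteq> 0"
  proof
    assume "\<mu> = 0"
    then have "AE w in M. ?\<xi> w = 0"
      using integral_nonneg_eq_0_iff_AE[OF int] \<xi>_pos by (simp add: mean eventually_mono)
    with \<xi>_pos have "AE w in M. False" by eventually_elim simp
    then show False by simp
  qed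
  moreover have "0 \<le> \<mu>" by (simp add: mu)
  ultimately have \<mu>_pos: "0 < \<mu>" by simp
  have var: "variance ?\<xi> = \<nu> - \<mu>\<^sup>2"
    using variance_eq[OF int sq] integral_X[of "\<lambda>x. (ln (1 - x))\<^sup>2"] mean by (simp add: nu)
  have "variance ?\<xi> \<noteq> 0"
  proof
    \<comment> \<open>A constant step would put all mass of \<open>\<omega>\<close> on the single point \<open>1 - exp (- \<mu>)\<close>, which is
      \<open>1 - x ^ j\<close> for \<open>x = exp (- \<mu>)\<close> and \<open>j = 1\<close>.\<close>
    assume "variance ?\<xi> = 0"
    moreover have "integrable M (\<lambda>w. (?\<xi> w - \<mu>)\<^sup>2)"
      using int sq by (simp add: power2_diff)
    ultimately have "AE w in M. (?\<xi> w - \<mu>)\<^sup>2 = 0"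
      using integral_nonneg_eq_0_iff_AE[of M "\<lambda>w. (?\<xi> w - \<mu>)\<^sup>2"] by (simp add: mean)
    with X_unit[of 0] have "AE w in M. X 0 w \<in> {1 - exp (- \<mu>) ^ j | j. j \<ge> 1}"
    proof eventually_elim
      case (elim w)
      then have "\<mu> = - ln (1 - X 0 w)" by simp
      then have "X 0 w = 1 - exp (- \<mu>) ^ 1" using elim(1) by simp
      then show ?case by blast
    qed
    moreover have [measurable]: "{1 - exp (- \<mu>) ^ j | j. j \<ge> 1} \<in> sets borel"
    proof -
      have "{1 - exp (- \<mu>) ^ j | j. j \<ge> 1} = (\<lambda>j. 1 - exp (- \<mu>) ^ j) ` {1..}" by auto
      then have "countable {1 - exp (- \<mu>) ^ j | j. j \<ge> 1}" by simp
      then show ?thesis by (rule sets.countable[rotated]) auto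
    qed
    ultimately have "AE x in \<omega>. x \<in> {1 - exp (- \<mu>) ^ j | j. j \<ge> 1}"
      unfolding X_distr[of 0, symmetric] by (subst AE_distr_iff) auto
    then have "measure \<omega> {1 - exp (- \<mu>) ^ j | j. j \<ge> 1} = 1"
      using omega.prob_eq_1[of "{1 - exp (- \<mu>) ^ j | j. j \<ge> 1}"] by simp
    moreover have "exp (- \<mu>) \<in> {0<..<1}" using \<mu>_pos by simp
    ultimately show False using not_geometric by blast
  qed
  moreover have "0 \<le> variance ?\<xi>" by (rule variance_positive)
  ultimately have "0 < variance ?\<xi>" by linarith
  then have "0 < \<nu> - \<mu>\<^sup>2" unfolding var .
  then have \<sigma>: "0 < \<sigma>" "\<sigma>\<^sup>2 = variance ?\<xi>" using var by (simp_all add: sigma)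
  show ?thesis
  proof (rule sieve.occupied_count_clt)
    show "integrable M (\<lambda>w. \<bar>ln (X 0 w)\<bar>)"
      using integrable_X[of "\<lambda>x. \<bar>ln x\<bar>"] log_integrable by simp
  qed (fact sq mean \<mu>_pos \<sigma>)+
qed

end
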